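(* Let $G$ be an amenable locally compact group and let $A\neq\{0\}$ be a weak$^*$-closed self-adjoint translation invariant subalgebra of $L^\infty(G)$. Let $P:L^\infty(G)\to A$ be a norm one projection such that $L^\infty(G)^*=P^*(A^* )\oplus A^\perp$, where $A^\perp$ is a weak$^*$-closed ideal of $L^\infty(G)^*$ and $P^*(A^* )$ is a unital closed subalgebra of $L^\infty(G)^*$. If $L^\infty(G)^*$ is ideally amenable, then $P^*(A^* )$ is ideally amenable.
   Context: Translation invariant means invariant under left and right translations by elements of $G$. $A^\perp=\{m\in L^\infty(G)^*:\langle m,f\rangle=0 \text{ for all } f\in A\}$, and $P^*:A^*\to L^\infty(G)^*$ is the adjoint of $P$. $L^\infty(G)^*=L^1(G)^{**}$ carries the product $\langle mn,f\rangle=\langle m,n\cdot f\rangle$, where $\langle n\cdot f,a\rangle=\langle n,f\cdot a\rangle$ and $\langle f\cdot a,b\rangle=\langle f,a*b\rangle$ for $m,n\in L^\infty(G)^*$, $f\in L^\infty(G)$, $a,b\in L^1(G)$. A Banach algebra $\mathcal A$ is ideally amenable if $H^1(\mathcal A,J^* )=\{0\}$ for every closed two-sided ideal $J$ of $\mathcal A$, i.e. every continuous derivation $D:\mathcal A\to J^*$ is inner, of the form $a\mapsto a\cdot\xi-\xi\cdot a$ with $\xi\in J^*$, where $\langle a\cdot\xi,x\rangle=\langle \xi,xa\rangle$ and $\langle \xi\cdot a,x\rangle=\langle\xi,ax\rangle$. *)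

theory Defs
  imports "HOL-Analysis.Analysis" "HOL-Algebra.AbelCoset" "HOL-Algebra.Module"
begin

section \<open>Complex normed spaces and Banach algebras with explicit carriers\<close>

text \<open>
  Complex normed spaces are modules in the sense of HOL-Algebra over the field of complex numbers,
  with an additional norm. The ring fields \<open>mult\<close> and \<open>one\<close> are only meaningful
  for algebras; \<open>one\<close> is never used as a unit of a Banach algebra, since Banach algebras
  are not assumed to be unital.
\<close>

record 'a normed = "(complex, 'a) module" +
  nrm :: "'a \<Rightarrow> real"

definition scalars :: "complex normed" where
  "scalars = \<lparr>carrier = UNIV, mult = (*), one = 1, zero = 0, add = (+), smult = (*), nrm = cmod\<rparr>"

text \<open>
  The locale \<open>Metric_space\<close> constrains the distance on the whole type, hence the value outside the carrier.
\<close>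

definition vdist :: "('a, 'm) normed_scheme \<Rightarrow> 'a \<Rightarrow> 'a \<Rightarrow> real" where
  "vdist E x y = (if x \<in> carrier E \<and> y \<in> carrier E then nrm E (x \<ominus>\<^bsub>E\<^esub> y) else 0)"

definition norm_topology :: "('a, 'm) normed_scheme \<Rightarrow> 'a topology" where
  "norm_topology E = Metric_space.mtopology (carrier E) (vdist E)"

definition normed_space :: "('a, 'm) normed_scheme \<Rightarrow> bool" where
  "normed_space E \<longleftrightarrow>
     module scalars E \<and>
     (\<forall>x\<in>carrier E. 0 \<le> nrm E x \<and> (nrm E x = 0 \<longleftrightarrow> x = \<zero>\<^bsub>E\<^esub>)) \<and>
     (\<forall>c. \<forall>x\<in>carrier E. nrm E (c \<odot>\<^bsub>E\<^esub> x) = cmod c * nrm E x) \<and>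
     (\<forall>x\<in>carrier E. \<forall>y\<in>carrier E. nrm E (x \<oplus>\<^bsub>E\<^esub> y) \<le> nrm E x + nrm E y)"

definition banach_space :: "('a, 'm) normed_scheme \<Rightarrow> bool" where
  "banach_space E \<longleftrightarrow> normed_space E \<and> Metric_space.mcomplete (carrier E) (vdist E)"

definition banach_algebra :: "('a, 'm) normed_scheme \<Rightarrow> bool" where
  "banach_algebra E \<longleftrightarrow>
     banach_space E \<and>
     (\<forall>x\<in>carrier E. \<forall>y\<in>carrier E.
        x \<otimes>\<^bsub>E\<^esub> y \<in> carrier E \<and> nrm E (x \<otimes>\<^bsub>E\<^esub> y) \<le> nrm E x * nrm E y \<and>
        (\<forall>c. (c \<odot>\<^bsub>E\<^esub> x) \<otimes>\<^bsub>E\<^esub> y = c \<odot>\<^bsub>E\<^esub> (x \<otimes>\<^bsub>E\<^esub> y) \<and> x \<otimes>\<^bsub>E\<^esub> (c \<odot>\<^bsub>E\<^esub> y) = c \<odot>\<^bsub>E\<^esub> (x \<otimes>\<^bsub>E\<^esub> y)) \<and>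
        (\<forall>z\<in>carrier E.
           (x \<otimes>\<^bsub>E\<^esub> y) \<otimes>\<^bsub>E\<^esub> z = x \<otimes>\<^bsub>E\<^esub> (y \<otimes>\<^bsub>E\<^esub> z) \<and>
           (x \<oplus>\<^bsub>E\<^esub> y) \<otimes>\<^bsub>E\<^esub> z = x \<otimes>\<^bsub>E\<^esub> z \<oplus>\<^bsub>E\<^esub> y \<otimes>\<^bsub>E\<^esub> z \<and>
           x \<otimes>\<^bsub>E\<^esub> (y \<oplus>\<^bsub>E\<^esub> z) = x \<otimes>\<^bsub>E\<^esub> y \<oplus>\<^bsub>E\<^esub> x \<otimes>\<^bsub>E\<^esub> z))"

definition subspace_of :: "'a set \<Rightarrow> ('a, 'm) normed_scheme \<Rightarrow> bool" where
  "subspace_of S E \<longleftrightarrow>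
     S \<subseteq> carrier E \<and> \<zero>\<^bsub>E\<^esub> \<in> S \<and>
     (\<forall>x\<in>S. \<forall>y\<in>S. x \<oplus>\<^bsub>E\<^esub> y \<in> S) \<and> (\<forall>c. \<forall>x\<in>S. c \<odot>\<^bsub>E\<^esub> x \<in> S)"

definition subalgebra_of :: "'a set \<Rightarrow> ('a, 'm) normed_scheme \<Rightarrow> bool" where
  "subalgebra_of S E \<longleftrightarrow> subspace_of S E \<and> (\<forall>x\<in>S. \<forall>y\<in>S. x \<otimes>\<^bsub>E\<^esub> y \<in> S)"

definition has_unit :: "'a set \<Rightarrow> ('a, 'm) normed_scheme \<Rightarrow> bool" where
  "has_unit S E \<longleftrightarrow> (\<exists>e\<in>S. \<forall>x\<in>S. e \<otimes>\<^bsub>E\<^esub> x = x \<and> x \<otimes>\<^bsub>E\<^esub> e = x)"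

definition two_sided_ideal :: "'a set \<Rightarrow> ('a, 'm) normed_scheme \<Rightarrow> bool" where
  "two_sided_ideal J E \<longleftrightarrow>
     subspace_of J E \<and> (\<forall>a\<in>carrier E. \<forall>x\<in>J. a \<otimes>\<^bsub>E\<^esub> x \<in> J \<and> x \<otimes>\<^bsub>E\<^esub> a \<in> J)"

definition direct_sum :: "('a, 'm) normed_scheme \<Rightarrow> 'a set \<Rightarrow> 'a set \<Rightarrow> bool" where
  "direct_sum E S T \<longleftrightarrow>
     subspace_of S E \<and> subspace_of T E \<and> carrier E = S <+>\<^bsub>E\<^esub> T \<and> S \<inter> T = {\<zero>\<^bsub>E\<^esub>}"

definition bounded_linear_map ::
  "('a, 'm) normed_scheme \<Rightarrow> ('b, 'n) normed_scheme \<Rightarrow> ('a \<Rightarrow> 'b) \<Rightarrow> bool" where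
  "bounded_linear_map E F T \<longleftrightarrow>
     T \<in> carrier E \<rightarrow> carrier F \<and>
     (\<forall>x\<in>carrier E. \<forall>y\<in>carrier E. T (x \<oplus>\<^bsub>E\<^esub> y) = T x \<oplus>\<^bsub>F\<^esub> T y) \<and>
     (\<forall>c. \<forall>x\<in>carrier E. T (c \<odot>\<^bsub>E\<^esub> x) = c \<odot>\<^bsub>F\<^esub> T x) \<and>
     (\<exists>K. \<forall>x\<in>carrier E. nrm F (T x) \<le> K * nrm E x)"

definition operator_norm ::
  "('a, 'm) normed_scheme \<Rightarrow> ('b, 'n) normed_scheme \<Rightarrow> ('a \<Rightarrow> 'b) \<Rightarrow> real" where
  "operator_norm E F T = Inf {K. 0 \<le> K \<and> (\<forall>x\<in>carrier E. nrm F (T x) \<le> K * nrm E x)}"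

definition norm_one_projection :: "('a, 'm) normed_scheme \<Rightarrow> 'a set \<Rightarrow> ('a \<Rightarrow> 'a) \<Rightarrow> bool" where
  "norm_one_projection E A P \<longleftrightarrow>
     bounded_linear_map E (E\<lparr>carrier := A\<rparr>) P \<and> (\<forall>x\<in>A. P x = x) \<and>
     operator_norm E (E\<lparr>carrier := A\<rparr>) P = 1"


section \<open>Dual spaces\<close>

text \<open>
  Functionals are represented by functions that are \<open>undefined\<close> outside the carrier, so that
  equality of functionals is equality of functions.
\<close>

definition dual :: "('a, 'm) normed_scheme \<Rightarrow> ('a \<Rightarrow> complex) normed" where
  "dual E = \<lparr>
     carrier = {\<phi> \<in> extensional (carrier E). bounded_linear_map E scalars \<phi>},
     mult = undefined,
     one = undefined,
     zero = (\<lambda>x\<in>carrier E. 0),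
     add = (\<lambda>\<phi> \<psi>. \<lambda>x\<in>carrier E. \<phi> x + \<psi> x),
     smult = (\<lambda>c \<phi>. \<lambda>x\<in>carrier E. c * \<phi> x),
     nrm = operator_norm E scalars\<rparr>"

definition weak_star_topology :: "('a, 'm) normed_scheme \<Rightarrow> ('a \<Rightarrow> complex) topology" where
  "weak_star_topology E =
     subtopology (product_topology (\<lambda>_. euclidean) (carrier E)) (carrier (dual E))"

definition annihilator :: "('a, 'm) normed_scheme \<Rightarrow> 'a set \<Rightarrow> ('a \<Rightarrow> complex) set" where
  "annihilator E A = {m \<in> carrier (dual E). \<forall>x\<in>A. m x = 0}"

definition adjoint_map ::
  "('a, 'm) normed_scheme \<Rightarrow> ('a \<Rightarrow> 'b) \<Rightarrow> ('b \<Rightarrow> complex) \<Rightarrow> ('a \<Rightarrow> complex)" where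
  "adjoint_map E T \<phi> = (\<lambda>x\<in>carrier E. \<phi> (T x))"


section \<open>Ideal amenability\<close>

text \<open>The module actions of an algebra on the dual \<open>J\<^sup>*\<close> of a two-sided ideal \<open>J\<close>.\<close>

definition left_act :: "('a, 'm) normed_scheme \<Rightarrow> 'a set \<Rightarrow> 'a \<Rightarrow> ('a \<Rightarrow> complex) \<Rightarrow> ('a \<Rightarrow> complex)" where
  "left_act E J a \<xi> = (\<lambda>x\<in>J. \<xi> (x \<otimes>\<^bsub>E\<^esub> a))"

definition right_act :: "('a, 'm) normed_scheme \<Rightarrow> 'a set \<Rightarrow> ('a \<Rightarrow> complex) \<Rightarrow> 'a \<Rightarrow> ('a \<Rightarrow> complex)" where
  "right_act E J \<xi> a = (\<lambda>x\<in>J. \<xi> (a \<otimes>\<^bsub>E\<^esub> x))"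

definition continuous_derivation ::
  "('a, 'm) normed_scheme \<Rightarrow> 'a set \<Rightarrow> ('a \<Rightarrow> ('a \<Rightarrow> complex)) \<Rightarrow> bool" where
  "continuous_derivation E J D \<longleftrightarrow>
     bounded_linear_map E (dual (E\<lparr>carrier := J\<rparr>)) D \<and>
     (\<forall>a\<in>carrier E. \<forall>b\<in>carrier E.
        D (a \<otimes>\<^bsub>E\<^esub> b) = left_act E J a (D b) \<oplus>\<^bsub>dual (E\<lparr>carrier := J\<rparr>)\<^esub> right_act E J (D a) b)"

definition inner_derivation ::
  "('a, 'm) normed_scheme \<Rightarrow> 'a set \<Rightarrow> ('a \<Rightarrow> ('a \<Rightarrow> complex)) \<Rightarrow> bool" where
  "inner_derivation E J D \<longleftrightarrow>
     (\<exists>\<xi>\<in>carrier (dual (E\<lparr>carrier := J\<rparr>)). \<forall>a\<in>carrier E.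
        D a = left_act E J a \<xi> \<ominus>\<^bsub>dual (E\<lparr>carrier := J\<rparr>)\<^esub> right_act E J \<xi> a)"

text \<open>
  Continuity of derivations is part of \<open>bounded_linear_map\<close>. Ideal amenability is a property of Banach
  algebras, so being one is included in the definition.
\<close>

definition ideally_amenable :: "('a, 'm) normed_scheme \<Rightarrow> bool" where
  "ideally_amenable E \<longleftrightarrow>
     banach_algebra E \<and>
     (\<forall>J. two_sided_ideal J E \<and> closedin (norm_topology E) J \<longrightarrow>
        (\<forall>D. continuous_derivation E J D \<longrightarrow> inner_derivation E J D))"


section \<open>Haar measure and function spaces on a locally compact group\<close>

text \<open>
  Groups are written additively, as in the type class \<open>topological_group_add\<close>, but are not
  assumed to be commutative. A left Haar measure is a nonzero left invariant Radon measure on the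
  Borel sets: finite on compact sets, outer regular on Borel sets, inner regular on open sets.
\<close>

definition left_haar_measure :: "'g::{topological_group_add, t2_space} measure \<Rightarrow> bool" where
  "left_haar_measure \<mu> \<longleftrightarrow>
     sets \<mu> = sets borel \<and>
     emeasure \<mu> UNIV \<noteq> 0 \<and>
     (\<forall>K. compact K \<longrightarrow> emeasure \<mu> K < \<infinity>) \<and>
     (\<forall>E\<in>sets borel. emeasure \<mu> E = (INF U\<in>{U. open U \<and> E \<subseteq> U}. emeasure \<mu> U)) \<and>
     (\<forall>U. open U \<longrightarrow> emeasure \<mu> U = (SUP K\<in>{K. compact K \<and> K \<subseteq> U}. emeasure \<mu> K)) \<and>
     (\<forall>s. \<forall>E\<in>sets borel. emeasure \<mu> ((\<lambda>x. s + x) ` E) = emeasure \<mu> E)"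

text \<open>
  Haar measure need not be sigma-finite. For \<open>L\<^sup>\<infinity>(G)\<close> to be the dual of \<open>L\<^sup>1(G)\<close> in general, it has to
  consist of \<^emph>\<open>locally\<close> measurable functions, bounded and identified \<^emph>\<open>locally\<close> almost everywhere, where
  locally means on every Borel set of finite measure.
\<close>

definition locally_AE :: "'g measure \<Rightarrow> ('g \<Rightarrow> bool) \<Rightarrow> bool" where
  "locally_AE \<mu> Q \<longleftrightarrow> (\<forall>F\<in>sets \<mu>. emeasure \<mu> F < \<infinity> \<longrightarrow> (AE x in \<mu>. x \<in> F \<longrightarrow> Q x))"

definition Linf_functions :: "'g measure \<Rightarrow> ('g \<Rightarrow> complex) set" where
  "Linf_functions \<mu> =
     {f. (\<forall>F\<in>sets \<mu>. emeasure \<mu> F < \<infinity> \<longrightarrow> f \<in> borel_measurable (restrict_space \<mu> F)) \<and>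
         (\<exists>c. locally_AE \<mu> (\<lambda>x. cmod (f x) \<le> c))}"

definition Linf_class :: "'g measure \<Rightarrow> ('g \<Rightarrow> complex) \<Rightarrow> ('g \<Rightarrow> complex) set" where
  "Linf_class \<mu> f = {g \<in> Linf_functions \<mu>. locally_AE \<mu> (\<lambda>x. g x = f x)}"

definition representative :: "('g \<Rightarrow> complex) set \<Rightarrow> ('g \<Rightarrow> complex)" where
  "representative F = (SOME f. f \<in> F)"

definition Linf :: "'g measure \<Rightarrow> ('g \<Rightarrow> complex) set normed" where
  "Linf \<mu> = \<lparr>
     carrier = Linf_class \<mu> ` Linf_functions \<mu>,
     mult = (\<lambda>F H. Linf_class \<mu> (\<lambda>x. representative F x * representative H x)),
     one = Linf_class \<mu> (\<lambda>x. 1),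
     zero = Linf_class \<mu> (\<lambda>x. 0),
     add = (\<lambda>F H. Linf_class \<mu> (\<lambda>x. representative F x + representative H x)),
     smult = (\<lambda>c F. Linf_class \<mu> (\<lambda>x. c * representative F x)),
     nrm = (\<lambda>F. Inf {c. 0 \<le> c \<and> locally_AE \<mu> (\<lambda>x. cmod (representative F x) \<le> c)})\<rparr>"

text \<open>
  Elements of \<open>L\<^sup>1(G)\<close> only ever occur as arguments of pairings, so they are given by integrable
  functions rather than by their classes modulo null functions.
\<close>

definition L1_functions :: "'g measure \<Rightarrow> ('g \<Rightarrow> complex) set" where
  "L1_functions \<mu> = {a. integrable \<mu> a}"

definition pairing :: "'g measure \<Rightarrow> ('g \<Rightarrow> complex) set \<Rightarrow> ('g \<Rightarrow> complex) \<Rightarrow> complex" where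
  "pairing \<mu> F a = (LINT x|\<mu>. representative F x * a x)"

definition convolution ::
  "'g::topological_group_add measure \<Rightarrow> ('g \<Rightarrow> complex) \<Rightarrow> ('g \<Rightarrow> complex) \<Rightarrow> ('g \<Rightarrow> complex)" where
  "convolution \<mu> a b = (\<lambda>x. LINT y|\<mu>. a y * b (- y + x))"

definition Linf_weak_star_topology :: "'g measure \<Rightarrow> ('g \<Rightarrow> complex) set topology" where
  "Linf_weak_star_topology \<mu> =
     pullback_topology (carrier (Linf \<mu>)) (\<lambda>F. \<lambda>a\<in>L1_functions \<mu>. pairing \<mu> F a)
       (product_topology (\<lambda>_. euclidean) (L1_functions \<mu>))"


section \<open>The Arens product on \<open>L\<^sup>\<infinity>(G)\<^sup>*\<close>\<close>

text \<open>
  \<open>L\<^sup>\<infinity>(G)\<close> is identified with the dual of \<open>L\<^sup>1(G)\<close>: an element of \<open>L\<^sup>\<infinity>(G)\<close> is specified by its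
  pairings with all of \<open>L\<^sup>1(G)\<close>.
\<close>

definition Linf_L1_act ::
  "'g::topological_group_add measure \<Rightarrow> ('g \<Rightarrow> complex) set \<Rightarrow> ('g \<Rightarrow> complex) \<Rightarrow> ('g \<Rightarrow> complex) set" where
  "Linf_L1_act \<mu> F a =
     (THE H. H \<in> carrier (Linf \<mu>) \<and>
        (\<forall>b\<in>L1_functions \<mu>. pairing \<mu> H b = pairing \<mu> F (convolution \<mu> a b)))"

definition bidual_Linf_act ::
  "'g::topological_group_add measure \<Rightarrow> (('g \<Rightarrow> complex) set \<Rightarrow> complex) \<Rightarrow>
     ('g \<Rightarrow> complex) set \<Rightarrow> ('g \<Rightarrow> complex) set" where
  "bidual_Linf_act \<mu> n F =
     (THE H. H \<in> carrier (Linf \<mu>) \<and>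
        (\<forall>a\<in>L1_functions \<mu>. pairing \<mu> H a = n (Linf_L1_act \<mu> F a)))"

definition Linf_dual_algebra ::
  "'g::topological_group_add measure \<Rightarrow> (('g \<Rightarrow> complex) set \<Rightarrow> complex) normed" where
  "Linf_dual_algebra \<mu> = (dual (Linf \<mu>))
     \<lparr>mult := (\<lambda>m n. \<lambda>F\<in>carrier (Linf \<mu>). m (bidual_Linf_act \<mu> n F))\<rparr>"


section \<open>Amenability, and subsets of \<open>L\<^sup>\<infinity>(G)\<close>\<close>

definition amenable_group :: "'g::topological_group_add measure \<Rightarrow> bool" where
  "amenable_group \<mu> \<longleftrightarrow>
     (\<exists>m\<in>carrier (dual (Linf \<mu>)).
        nrm (dual (Linf \<mu>)) m = 1 \<and> m \<one>\<^bsub>Linf \<mu>\<^esub> = 1 \<and>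
        (\<forall>s. \<forall>f\<in>Linf_functions \<mu>.
           m (Linf_class \<mu> (\<lambda>x. f (s + x))) = m (Linf_class \<mu> f)))"

definition self_adjoint :: "'g measure \<Rightarrow> ('g \<Rightarrow> complex) set set \<Rightarrow> bool" where
  "self_adjoint \<mu> A \<longleftrightarrow>
     (\<forall>f\<in>Linf_functions \<mu>. Linf_class \<mu> f \<in> A \<longrightarrow> Linf_class \<mu> (\<lambda>x. cnj (f x)) \<in> A)"

definition translation_invariant ::
  "'g::topological_group_add measure \<Rightarrow> ('g \<Rightarrow> complex) set set \<Rightarrow> bool" where
  "translation_invariant \<mu> A \<longleftrightarrow>
     (\<forall>s. \<forall>f\<in>Linf_functions \<mu>. Linf_class \<mu> f \<in> A \<longrightarrow>
        Linf_class \<mu> (\<lambda>x. f (s + x)) \<in> A \<and> Linf_class \<mu> (\<lambda>x. f (x + s)) \<in> A)"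

end

theory Submission
  imports Defs
begin

text \<open>
  Write \<open>E = L\<^sup>\<infinity>(G)\<^sup>*\<close> and \<open>S = P\<^sup>*(A\<^sup>*)\<close>. The map \<open>\<pi> m = m \<circ> P\<close> restricts a functional to \<open>A\<close> and
  extends it again along \<open>P\<close>. It is a bounded projection of \<open>E\<close> onto \<open>S\<close> whose kernel is \<open>A\<^sup>\<bottom>\<close>
  (\<open>adjoint_projection\<close>). Because \<open>A\<^sup>\<bottom>\<close> is an ideal and \<open>S\<close> a subalgebra, \<open>\<pi>\<close> is a homomorphism
  (\<open>projection_multiplicative\<close>), so \<open>S\<close> is a retract of \<open>E\<close> in the category of Banach algebras, isomorphic to
  the quotient of \<open>E\<close> by \<open>A\<^sup>\<bottom>\<close>.

  Ideal amenability passes to such retracts (\<open>ideally_amenable_retract\<close>). Given a closed ideal \<open>J\<close> of \<open>S\<close> and a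
  continuous derivation \<open>D : S \<rightarrow> J\<^sup>*\<close>, the set \<open>K = \<pi>\<^sup>-\<^sup>1(J)\<close> is a closed ideal of \<open>E\<close> containing \<open>J\<close>, and
  \<open>b \<mapsto> D (\<pi> b) \<circ> \<pi>\<close> is a continuous derivation \<open>E \<rightarrow> K\<^sup>*\<close>. A functional \<open>\<xi>\<close> on \<open>K\<close> that makes the latter inner
  satisfies \<open>D a x = \<xi> (xa) - \<xi> (ax)\<close> for \<open>a \<in> S\<close> and \<open>x \<in> J\<close>, since \<open>\<pi>\<close> fixes both, and so the restriction of
  \<open>\<xi>\<close> to \<open>J\<close> makes \<open>D\<close> inner.
\<close>


section \<open>Normed spaces, subspaces and bounded maps\<close>

lemma module_minus_eq:
  assumes "module scalars E" "x \<in> carrier E" "y \<in> carrier E"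
  shows "x \<ominus>\<^bsub>E\<^esub> y = x \<oplus>\<^bsub>E\<^esub> (-1) \<odot>\<^bsub>E\<^esub> y"
proof -
  interpret module scalars E by fact
  have c: "c \<in> carrier scalars" for c
    by (simp add: scalars_def)
  have "(-1) \<odot>\<^bsub>E\<^esub> y \<oplus>\<^bsub>E\<^esub> y = ((-1) \<oplus>\<^bsub>scalars\<^esub> \<one>\<^bsub>scalars\<^esub>) \<odot>\<^bsub>E\<^esub> y"
    using assms(3) by (simp add: smult_l_distr c)
  also have "\<dots> = \<zero>\<^bsub>scalars\<^esub> \<odot>\<^bsub>E\<^esub> y"
    by (simp add: scalars_def)
  also have "\<dots> = \<zero>\<^bsub>E\<^esub>"
    using assms(3) by simp
  finally have "\<ominus>\<^bsub>E\<^esub> y = (-1) \<odot>\<^bsub>E\<^esub> y"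
    using assms(3) by (intro M.minus_equality) (simp_all add: c)
  then show ?thesis
    by (simp add: a_minus_def)
qed

lemma module_subspace:
  assumes "module scalars E" "subspace_of S E"
  shows "module scalars (E\<lparr>carrier := S\<rparr>)"
proof -
  interpret module scalars E by fact
  have "submodule S scalars E"
  proof (rule submoduleI)
    fix a assume a: "a \<in> S"
    then have "a \<in> carrier E"
      using assms(2) by (auto simp: subspace_of_def)
    then have "\<ominus>\<^bsub>E\<^esub> a = (-1) \<odot>\<^bsub>E\<^esub> a"
      using module_minus_eq[OF assms(1), of "\<zero>\<^bsub>E\<^esub>" a] smult_closed[of "-1" a]
      by (simp add: a_minus_def) (simp add: scalars_def)
    then show "\<ominus>\<^bsub>E\<^esub> a \<in> S"
      using a assms(2) by (simp add: subspace_of_def)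
  qed (use assms(2) in \<open>auto simp: subspace_of_def\<close>)
  then show ?thesis
    by (rule submodule.submodule_is_module) (fact assms(1))
qed

lemma normed_space_subspace:
  assumes "normed_space E" "subspace_of S E"
  shows "normed_space (E\<lparr>carrier := S\<rparr>)"
  using assms module_subspace[of E S]
  by (auto simp: normed_space_def subspace_of_def subset_iff)

lemma subspace_minus_eq:
  assumes "module scalars E" "subspace_of S E" "x \<in> S" "y \<in> S"
  shows "x \<ominus>\<^bsub>E\<lparr>carrier := S\<rparr>\<^esub> y = x \<ominus>\<^bsub>E\<^esub> y"
  using assms module_minus_eq[OF assms(1), of x y]
    module_minus_eq[OF module_subspace[OF assms(1,2)], of x y]
  by (simp add: subspace_of_def subset_iff)

lemma Metric_space_vdist:
  assumes E: "normed_space E"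
  shows "Metric_space (carrier E) (vdist E)"
proof -
  interpret module scalars E
    using E by (simp add: normed_space_def)
  have diff: "x \<ominus>\<^bsub>E\<^esub> y = (-1) \<odot>\<^bsub>E\<^esub> (y \<ominus>\<^bsub>E\<^esub> x)" if "x \<in> carrier E" "y \<in> carrier E" for x y
  proof -
    have "(-1) \<odot>\<^bsub>E\<^esub> (y \<ominus>\<^bsub>E\<^esub> x) = \<zero>\<^bsub>E\<^esub> \<ominus>\<^bsub>E\<^esub> (y \<ominus>\<^bsub>E\<^esub> x)"
      using that module_minus_eq[OF module_axioms, of "\<zero>\<^bsub>E\<^esub>" "y \<ominus>\<^bsub>E\<^esub> x"] smult_closed[of "-1"]
      by (simp add: scalars_def)
    also have "\<dots> = x \<ominus>\<^bsub>E\<^esub> y"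
      using that by (simp add: a_minus_def M.minus_add M.a_comm)
    finally show ?thesis ..
  qed
  show ?thesis
  proof
    fix x y
    show "0 \<le> vdist E x y"
      using E by (auto simp: vdist_def normed_space_def)
    show "vdist E x y = vdist E y x"
    proof (cases "x \<in> carrier E \<and> y \<in> carrier E")
      case True
      then have "nrm E (x \<ominus>\<^bsub>E\<^esub> y) = nrm E (y \<ominus>\<^bsub>E\<^esub> x)"
        using E diff[of x y] by (simp add: normed_space_def)
      then show ?thesis
        by (simp add: vdist_def)
    qed (auto simp: vdist_def)
  next
    fix x y assume xy: "x \<in> carrier E" "y \<in> carrier E"
    then have "x \<ominus>\<^bsub>E\<^esub> y = \<zero>\<^bsub>E\<^esub> \<longleftrightarrow> x = y"
      using M.minus_equality[of x "\<ominus>\<^bsub>E\<^esub> y"] by (auto simp: a_minus_def M.r_neg)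
    with xy show "vdist E x y = 0 \<longleftrightarrow> x = y"
      using E by (simp add: vdist_def normed_space_def)
  next
    fix x y z assume xyz: "x \<in> carrier E" "y \<in> carrier E" "z \<in> carrier E"
    have "x \<ominus>\<^bsub>E\<^esub> z = (x \<ominus>\<^bsub>E\<^esub> y) \<oplus>\<^bsub>E\<^esub> (y \<ominus>\<^bsub>E\<^esub> z)"
      using xyz by (simp add: a_minus_def M.a_assoc M.r_neg1)
    then show "vdist E x z \<le> vdist E x y + vdist E y z"
      using E xyz by (simp add: vdist_def normed_space_def)
  qed
qed

text \<open>
  A metric is a function on the whole type, so the distances of a space and of a subspace differ outside
  the subspace; neither the topology nor completeness sees the difference.
\<close>

lemma mtopology_cong:
  assumes "Metric_space M d" "Metric_space M d'"
    and "\<And>x y. x \<in> M \<Longrightarrow> y \<in> M \<Longrightarrow> d x y = d' x y"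
  shows "Metric_space.mtopology M d = Metric_space.mtopology M d'"
proof -
  have "Metric_space.mball M d = Metric_space.mball M d'"
    using assms(3) by (auto simp: fun_eq_iff Metric_space.mball_def[OF assms(1)] Metric_space.mball_def[OF assms(2)])
  then have "Metric_space.mopen M d = Metric_space.mopen M d'"
    by (simp add: fun_eq_iff Metric_space.mopen_def[OF assms(1)] Metric_space.mopen_def[OF assms(2)])
  then show ?thesis
    by (simp add: Metric_space.mtopology_def[OF assms(1)] Metric_space.mtopology_def[OF assms(2)])
qed

lemma mcomplete_cong:
  assumes "Metric_space M d" "Metric_space M d'"
    and "\<And>x y. x \<in> M \<Longrightarrow> y \<in> M \<Longrightarrow> d x y = d' x y"
  shows "Metric_space.mcomplete M d = Metric_space.mcomplete M d'"
proof -
  have "Metric_space.MCauchy M d \<sigma> = Metric_space.MCauchy M d' \<sigma>" for \<sigma>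
    using assms(3)
    by (auto simp: Metric_space.MCauchy_def[OF assms(1)] Metric_space.MCauchy_def[OF assms(2)]
      image_subset_iff)
  then show ?thesis
    using mtopology_cong[OF assms]
    by (simp add: Metric_space.mcomplete_def[OF assms(1)] Metric_space.mcomplete_def[OF assms(2)])
qed

lemma vdist_subspace:
  assumes "normed_space E" "subspace_of S E" "x \<in> S" "y \<in> S"
  shows "vdist (E\<lparr>carrier := S\<rparr>) x y = vdist E x y"
  using assms subspace_minus_eq[of E S x y]
  by (auto simp: vdist_def normed_space_def subspace_of_def)

lemma Submetric_vdist:
  assumes "normed_space E" "subspace_of S E"
  shows "Submetric (carrier E) (vdist E) S"
  using Metric_space_vdist[OF assms(1)] assms(2)
  by (simp add: Submetric_def Submetric_axioms_def subspace_of_def)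

lemma norm_topology_subspace:
  assumes "normed_space E" "subspace_of S E"
  shows "norm_topology (E\<lparr>carrier := S\<rparr>) = subtopology (norm_topology E) S"
proof -
  interpret Submetric "carrier E" "vdist E" S
    using assms by (rule Submetric_vdist)
  have "norm_topology (E\<lparr>carrier := S\<rparr>) = sub.mtopology"
    unfolding norm_topology_def
    using mtopology_cong[OF Metric_space_vdist[OF normed_space_subspace[OF assms], simplified] sub.Metric_space_axioms]
      vdist_subspace[OF assms] by simp
  then show ?thesis
    by (simp add: mtopology_submetric norm_topology_def)
qed

lemma banach_space_subspace:
  assumes "banach_space E" "subspace_of S E" "closedin (norm_topology E) S"
  shows "banach_space (E\<lparr>carrier := S\<rparr>)"
proof -
  have E: "normed_space E"
    using assms(1) by (simp add: banach_space_def)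
  interpret Submetric "carrier E" "vdist E" S
    using E assms(2) by (rule Submetric_vdist)
  have "sub.mcomplete"
    using assms(1,3) by (intro closedin_mcomplete_imp_mcomplete) (simp_all add: banach_space_def norm_topology_def)
  then have "Metric_space.mcomplete S (vdist (E\<lparr>carrier := S\<rparr>))"
    using mcomplete_cong[OF Metric_space_vdist[OF normed_space_subspace[OF E assms(2)], simplified] sub.Metric_space_axioms]
      vdist_subspace[OF E assms(2)] by simp
  then show ?thesis
    using normed_space_subspace[OF E assms(2)] by (simp add: banach_space_def)
qed

lemma banach_algebra_subalgebra:
  assumes "banach_algebra E" "subalgebra_of S E" "closedin (norm_topology E) S"
  shows "banach_algebra (E\<lparr>carrier := S\<rparr>)"
proof -
  have S: "subspace_of S E" "S \<subseteq> carrier E"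
    using assms(2) by (auto simp: subalgebra_of_def subspace_of_def)
  have "banach_space (E\<lparr>carrier := S\<rparr>)"
    using assms(1,3) S(1) by (intro banach_space_subspace) (simp_all add: banach_algebra_def)
  then show ?thesis
    using assms(1,2) S(2) by (auto simp: banach_algebra_def subalgebra_of_def subset_iff)
qed

lemma bounded_linear_map_bound:
  assumes "bounded_linear_map E F T" "\<And>x. x \<in> carrier E \<Longrightarrow> 0 \<le> nrm E x"
  obtains K where "0 \<le> K" "\<And>x. x \<in> carrier E \<Longrightarrow> nrm F (T x) \<le> K * nrm E x"
proof -
  obtain K where K: "\<And>x. x \<in> carrier E \<Longrightarrow> nrm F (T x) \<le> K * nrm E x"
    using assms(1) unfolding bounded_linear_map_def by blast
  have "nrm F (T x) \<le> \<bar>K\<bar> * nrm E x" if "x \<in> carrier E" for x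
    using K[OF that] assms(2)[OF that] mult_right_mono[OF abs_ge_self[of K] assms(2)[OF that]] by linarith
  then show thesis
    using that[of "\<bar>K\<bar>"] by simp
qed

lemma operator_norm_le:
  assumes "0 \<le> K" "\<And>x. x \<in> carrier E \<Longrightarrow> nrm F (T x) \<le> K * nrm E x"
  shows "operator_norm E F T \<le> K"
  unfolding operator_norm_def
  by (rule cInf_lower) (use assms in \<open>auto intro: bdd_belowI[of _ 0]\<close>)

lemma operator_norm_nonneg:
  assumes "bounded_linear_map E F T" "\<And>x. x \<in> carrier E \<Longrightarrow> 0 \<le> nrm E x"
  shows "0 \<le> operator_norm E F T"
proof -
  obtain K where "0 \<le> K" "\<And>x. x \<in> carrier E \<Longrightarrow> nrm F (T x) \<le> K * nrm E x"
    using bounded_linear_map_bound[OF assms] by blast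
  then show ?thesis
    unfolding operator_norm_def by (intro cInf_greatest) auto
qed

lemma operator_norm_bound:
  assumes T: "bounded_linear_map E F T" and nn: "\<And>x. x \<in> carrier E \<Longrightarrow> 0 \<le> nrm E x"
    and x: "x \<in> carrier E"
  shows "nrm F (T x) \<le> operator_norm E F T * nrm E x"
proof -
  obtain K where K: "0 \<le> K" "\<And>x. x \<in> carrier E \<Longrightarrow> nrm F (T x) \<le> K * nrm E x"
    using bounded_linear_map_bound[OF T nn] by blast
  show ?thesis
  proof (cases "nrm E x = 0")
    case True
    then show ?thesis using K(2)[OF x] by simp
  next
    case False
    then have pos: "0 < nrm E x" using nn[OF x] by simp
    have "nrm F (T x) / nrm E x \<le> operator_norm E F T"
      unfolding operator_norm_def
    proof (rule cInf_greatest)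
      show "{K. 0 \<le> K \<and> (\<forall>x\<in>carrier E. nrm F (T x) \<le> K * nrm E x)} \<noteq> {}"
        using K by auto
    qed (use pos x in \<open>auto simp: divide_simps\<close>)
    then show ?thesis
      using pos by (simp add: divide_simps)
  qed
qed

lemma continuous_map_bounded_linear:
  assumes E: "normed_space E" and F: "normed_space F" and T: "bounded_linear_map E F T"
  shows "continuous_map (norm_topology E) (norm_topology F) T"
proof -
  interpret ME: Metric_space "carrier E" "vdist E"
    using E by (rule Metric_space_vdist)
  have mod: "module scalars E" "module scalars F"
    using E F by (simp_all add: normed_space_def)
  interpret E: module scalars E by fact
  obtain K where K: "0 \<le> K" "\<And>x. x \<in> carrier E \<Longrightarrow> nrm F (T x) \<le> K * nrm E x"
    using bounded_linear_map_bound[OF T] E by (auto simp: normed_space_def)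
  have TF: "T x \<in> carrier F" if "x \<in> carrier E" for x
    using T that by (auto simp: bounded_linear_map_def)
  have lip: "vdist F (T x) (T y) \<le> K * vdist E x y" if xy: "x \<in> carrier E" "y \<in> carrier E" for x y
  proof -
    have "(-1) \<odot>\<^bsub>E\<^esub> y \<in> carrier E"
      using xy(2) E.smult_closed by (simp add: scalars_def)
    then have "T (x \<ominus>\<^bsub>E\<^esub> y) = T x \<ominus>\<^bsub>F\<^esub> T y"
      using T xy TF by (simp add: module_minus_eq mod bounded_linear_map_def)
    then show ?thesis
      using K(2)[of "x \<ominus>\<^bsub>E\<^esub> y"] xy TF by (simp add: vdist_def)
  qed
  show ?thesis
    unfolding norm_topology_def ME.metric_continuous_map[OF Metric_space_vdist[OF F]]
  proof (intro conjI ballI allI impI)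
    show "T ` carrier E \<subseteq> carrier F" using TF by auto
    fix a and \<epsilon> :: real assume a: "a \<in> carrier E" and \<epsilon>: "0 < \<epsilon>"
    have "vdist F (T a) (T x) < \<epsilon>" if x: "x \<in> carrier E \<and> vdist E a x < \<epsilon> / (K + 1)" for x
    proof -
      have "vdist F (T a) (T x) \<le> (K + 1) * vdist E a x"
        using lip[of a x] a x ME.nonneg[of a x] unfolding distrib_right by linarith
      also have "\<dots> < \<epsilon>"
        using x K(1) by (simp add: field_simps)
      finally show ?thesis .
    qed
    \<comment> \<open>The denominator is \<open>K + 1\<close> because \<open>K\<close> may be zero.\<close>
    then show "\<exists>\<delta>>0. \<forall>x. x \<in> carrier E \<and> vdist E a x < \<delta> \<longrightarrow> vdist F (T a) (T x) < \<epsilon>"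
      using K(1) \<epsilon> by (intro exI[of _ "\<epsilon> / (K + 1)"]) auto
  qed
qed


section \<open>Dual spaces\<close>

lemma in_carrier_dual_iff:
  "\<phi> \<in> carrier (dual E) \<longleftrightarrow>
     \<phi> \<in> extensional (carrier E) \<and>
     (\<forall>x\<in>carrier E. \<forall>y\<in>carrier E. \<phi> (x \<oplus>\<^bsub>E\<^esub> y) = \<phi> x + \<phi> y) \<and>
     (\<forall>c. \<forall>x\<in>carrier E. \<phi> (c \<odot>\<^bsub>E\<^esub> x) = c * \<phi> x) \<and>
     (\<exists>K. \<forall>x\<in>carrier E. cmod (\<phi> x) \<le> K * nrm E x)"
  by (simp add: dual_def bounded_linear_map_def scalars_def)

lemma dual_norm_bound:
  assumes "\<phi> \<in> carrier (dual E)" "\<And>x. x \<in> carrier E \<Longrightarrow> 0 \<le> nrm E x" "x \<in> carrier E"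
  shows "cmod (\<phi> x) \<le> nrm (dual E) \<phi> * nrm E x"
  using operator_norm_bound[of E scalars \<phi> x] assms by (simp add: dual_def scalars_def)

lemma dual_norm_nonneg:
  assumes "\<phi> \<in> carrier (dual E)" "\<And>x. x \<in> carrier E \<Longrightarrow> 0 \<le> nrm E x"
  shows "0 \<le> nrm (dual E) \<phi>"
  using operator_norm_nonneg[of E scalars \<phi>] assms by (simp add: dual_def)

lemma dual_norm_le:
  assumes "0 \<le> K" "\<And>x. x \<in> carrier E \<Longrightarrow> cmod (\<phi> x) \<le> K * nrm E x"
  shows "nrm (dual E) \<phi> \<le> K"
  using operator_norm_le[of K E scalars \<phi>] assms by (simp add: dual_def scalars_def)

lemma module_dual:
  assumes "module scalars E"
  shows "module scalars (dual E)"
proof -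
  interpret module scalars E by fact
  have cl: "x \<oplus>\<^bsub>E\<^esub> y \<in> carrier E" "c \<odot>\<^bsub>E\<^esub> x \<in> carrier E" if "x \<in> carrier E" "y \<in> carrier E" for x y c
    using that smult_closed[of c x] by (simp_all add: scalars_def)
  have add: "\<phi> \<oplus>\<^bsub>dual E\<^esub> \<psi> \<in> carrier (dual E)"
    if \<phi>: "\<phi> \<in> carrier (dual E)" and \<psi>: "\<psi> \<in> carrier (dual E)" for \<phi> \<psi>
  proof -
    obtain K L where KL: "\<And>x. x \<in> carrier E \<Longrightarrow> cmod (\<phi> x) \<le> K * nrm E x"
      "\<And>x. x \<in> carrier E \<Longrightarrow> cmod (\<psi> x) \<le> L * nrm E x"
      using \<phi> \<psi> unfolding in_carrier_dual_iff by blast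
    have "cmod (\<phi> x + \<psi> x) \<le> (K + L) * nrm E x" if "x \<in> carrier E" for x
      using norm_triangle_ineq[of "\<phi> x" "\<psi> x"] KL[OF that] by (simp add: algebra_simps)
    then have "\<exists>C. \<forall>x\<in>carrier E. cmod (\<phi> x + \<psi> x) \<le> C * nrm E x"
      by blast
    with \<phi> \<psi> show ?thesis
      unfolding in_carrier_dual_iff by (simp add: dual_def cl algebra_simps)
  qed
  have smult: "c \<odot>\<^bsub>dual E\<^esub> \<phi> \<in> carrier (dual E)" if \<phi>: "\<phi> \<in> carrier (dual E)" for c \<phi>
  proof -
    obtain K where K: "\<And>x. x \<in> carrier E \<Longrightarrow> cmod (\<phi> x) \<le> K * nrm E x"
      using \<phi> unfolding in_carrier_dual_iff by blast
    have "cmod (c * \<phi> x) \<le> (cmod c * K) * nrm E x" if "x \<in> carrier E" for x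
      using mult_left_mono[OF K[OF that], of "cmod c"] by (simp add: norm_mult mult.assoc)
    then have "\<exists>C. \<forall>x\<in>carrier E. cmod (c * \<phi> x) \<le> C * nrm E x"
      by blast
    with \<phi> show ?thesis
      unfolding in_carrier_dual_iff by (simp add: dual_def cl algebra_simps)
  qed
  have zero: "\<zero>\<^bsub>dual E\<^esub> \<in> carrier (dual E)"
    unfolding in_carrier_dual_iff by (auto simp: dual_def cl intro: exI[of _ 0])
  have ext: "\<phi> = restrict \<phi> (carrier E)" if "\<phi> \<in> carrier (dual E)" for \<phi>
    using that by (simp add: in_carrier_dual_iff extensional_restrict)
  show ?thesis
  proof (rule moduleI)
    show "cring scalars" ..
    show "abelian_group (dual E)"
    proof (rule abelian_groupI)
      fix \<phi> assume \<phi>: "\<phi> \<in> carrier (dual E)"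
      show "\<zero>\<^bsub>dual E\<^esub> \<oplus>\<^bsub>dual E\<^esub> \<phi> = \<phi>"
        by (subst (2) ext[OF \<phi>]) (auto simp: dual_def)
      have "(-1) \<odot>\<^bsub>dual E\<^esub> \<phi> \<oplus>\<^bsub>dual E\<^esub> \<phi> = \<zero>\<^bsub>dual E\<^esub>"
        by (auto simp: dual_def)
      then show "\<exists>\<psi>\<in>carrier (dual E). \<psi> \<oplus>\<^bsub>dual E\<^esub> \<phi> = \<zero>\<^bsub>dual E\<^esub>"
        using smult[OF \<phi>] by blast
    qed (use add zero in \<open>auto simp: dual_def add.assoc add.commute\<close>)
    fix \<phi> assume \<phi>: "\<phi> \<in> carrier (dual E)"
    show "\<one>\<^bsub>scalars\<^esub> \<odot>\<^bsub>dual E\<^esub> \<phi> = \<phi>"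
      by (subst (2) ext[OF \<phi>]) (auto simp: dual_def scalars_def)
  qed (use smult in \<open>auto simp: dual_def scalars_def algebra_simps\<close>)
qed

lemma dual_minus_eq:
  assumes "module scalars E" "\<phi> \<in> carrier (dual E)" "\<psi> \<in> carrier (dual E)"
  shows "\<phi> \<ominus>\<^bsub>dual E\<^esub> \<psi> = (\<lambda>x\<in>carrier E. \<phi> x - \<psi> x)"
  using module_minus_eq[OF module_dual[OF assms(1)] assms(2,3)] by (auto simp: dual_def)

lemma restrict_in_dual_subspace:
  assumes "\<phi> \<in> carrier (dual E)" "subspace_of S E"
  shows "restrict \<phi> S \<in> carrier (dual (E\<lparr>carrier := S\<rparr>))"
proof -
  have S: "x \<in> carrier E" if "x \<in> S" for x
    using assms(2) that by (auto simp: subspace_of_def)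
  have "\<exists>K. \<forall>x\<in>carrier E. cmod (\<phi> x) \<le> K * nrm E x"
    using assms(1) by (simp add: in_carrier_dual_iff)
  then have "\<exists>K. \<forall>x\<in>S. cmod (\<phi> x) \<le> K * nrm E x"
    using S by blast
  then show ?thesis
    using assms unfolding in_carrier_dual_iff subspace_of_def by (simp add: S)
qed

text \<open>
  An element \<open>a\<close> acts boundedly on the dual of an ideal because \<open>x \<mapsto> xa\<close> and \<open>x \<mapsto> ax\<close> have norm
  at most \<open>\<parallel>a\<parallel>\<close>.
\<close>

lemma module_actions_in_dual:
  assumes E: "banach_algebra E" and J: "two_sided_ideal J E"
    and \<xi>: "\<xi> \<in> carrier (dual (E\<lparr>carrier := J\<rparr>))" and a: "a \<in> carrier E"
  shows "left_act E J a \<xi> \<in> carrier (dual (E\<lparr>carrier := J\<rparr>))"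
    and "right_act E J \<xi> a \<in> carrier (dual (E\<lparr>carrier := J\<rparr>))"
proof -
  have sub: "x \<in> carrier E" if "x \<in> J" for x
    using J that by (auto simp: two_sided_ideal_def subspace_of_def)
  have nn: "0 \<le> nrm E x" if "x \<in> carrier E" for x
    using E that by (simp add: banach_algebra_def banach_space_def normed_space_def)
  have alg: "x \<otimes>\<^bsub>E\<^esub> a \<in> J" "a \<otimes>\<^bsub>E\<^esub> x \<in> J"
    "nrm E (x \<otimes>\<^bsub>E\<^esub> a) \<le> nrm E a * nrm E x" "nrm E (a \<otimes>\<^bsub>E\<^esub> x) \<le> nrm E a * nrm E x"
    if "x \<in> J" for x
    using E J a that sub[OF that] by (auto simp: banach_algebra_def two_sided_ideal_def mult.commute)
  obtain K where K: "0 \<le> K" "\<And>x. x \<in> J \<Longrightarrow> cmod (\<xi> x) \<le> K * nrm E x"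
    using bounded_linear_map_bound[of "E\<lparr>carrier := J\<rparr>" scalars \<xi>] \<xi> nn sub
    by (auto simp: dual_def scalars_def)
  have bound: "cmod (\<xi> z) \<le> (K * nrm E a) * nrm E x"
    if "z \<in> J" "nrm E z \<le> nrm E a * nrm E x" for z x
    using K(2)[OF that(1)] mult_left_mono[OF that(2) K(1)] by (simp add: mult.assoc)
  have "\<exists>C. \<forall>x\<in>J. cmod (\<xi> (x \<otimes>\<^bsub>E\<^esub> a)) \<le> C * nrm E x"
    "\<exists>C. \<forall>x\<in>J. cmod (\<xi> (a \<otimes>\<^bsub>E\<^esub> x)) \<le> C * nrm E x"
    using bound alg by blast+
  with E J \<xi> a alg(1,2) sub
  show "left_act E J a \<xi> \<in> carrier (dual (E\<lparr>carrier := J\<rparr>))"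
    and "right_act E J \<xi> a \<in> carrier (dual (E\<lparr>carrier := J\<rparr>))"
    unfolding in_carrier_dual_iff
    by (auto simp: left_act_def right_act_def two_sided_ideal_def subspace_of_def banach_algebra_def)
qed

lemma commutator_action_eq:
  assumes E: "banach_algebra E" and J: "two_sided_ideal J E"
    and \<xi>: "\<xi> \<in> carrier (dual (E\<lparr>carrier := J\<rparr>))" and a: "a \<in> carrier E"
  shows "left_act E J a \<xi> \<ominus>\<^bsub>dual (E\<lparr>carrier := J\<rparr>)\<^esub> right_act E J \<xi> a =
    (\<lambda>x\<in>J. \<xi> (x \<otimes>\<^bsub>E\<^esub> a) - \<xi> (a \<otimes>\<^bsub>E\<^esub> x))"
proof -
  have "module scalars (E\<lparr>carrier := J\<rparr>)"
    using E J by (intro module_subspace)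
      (simp_all add: banach_algebra_def banach_space_def normed_space_def two_sided_ideal_def)
  from dual_minus_eq[OF this module_actions_in_dual[OF assms]] show ?thesis
    by (auto simp: left_act_def right_act_def)
qed


section \<open>Ideal amenability passes to retracts\<close>

text \<open>
  As \<open>\<pi>\<close> is a homomorphism, acting by \<open>b\<close> on a functional \<open>\<phi> \<circ> \<pi>\<close> gives \<open>\<psi> \<circ> \<pi>\<close>, where \<open>\<psi>\<close> is the result
  of acting by \<open>\<pi> b\<close> on \<open>\<phi>\<close>. The derivation identity for \<open>D\<close> at \<open>\<pi> a\<close> and \<open>\<pi> b\<close>, composed with \<open>\<pi>\<close>, is therefore
  the one for the pullback at \<open>a\<close> and \<open>b\<close>.
\<close>

lemma continuous_derivation_pullback:
  assumes E: "normed_space E" and F: "normed_space F"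
    and \<pi>: "bounded_linear_map E F \<pi>"
    and mult: "\<And>x y. x \<in> carrier E \<Longrightarrow> y \<in> carrier E \<Longrightarrow> \<pi> (x \<otimes>\<^bsub>E\<^esub> y) = \<pi> x \<otimes>\<^bsub>F\<^esub> \<pi> y"
    and K: "two_sided_ideal K E" and J: "two_sided_ideal J F" and KJ: "\<pi> ` K \<subseteq> J"
    and D: "continuous_derivation F J D"
  shows "continuous_derivation E K (\<lambda>b. \<lambda>x\<in>K. D (\<pi> b) (\<pi> x))"
proof -
  let ?EK = "E\<lparr>carrier := K\<rparr>" and ?FJ = "F\<lparr>carrier := J\<rparr>"
  let ?D = "\<lambda>b. \<lambda>x\<in>K. D (\<pi> b) (\<pi> x)"
  have KE: "x \<in> carrier E" if "x \<in> K" for x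
    using K that by (auto simp: two_sided_ideal_def subspace_of_def)
  have Kcl: "x \<oplus>\<^bsub>E\<^esub> y \<in> K" "c \<odot>\<^bsub>E\<^esub> x \<in> K" if "x \<in> K" "y \<in> K" for x y c
    using K that by (auto simp: two_sided_ideal_def subspace_of_def)
  have Kideal: "x \<otimes>\<^bsub>E\<^esub> a \<in> K" "a \<otimes>\<^bsub>E\<^esub> x \<in> K" if "x \<in> K" "a \<in> carrier E" for x a
    using K that by (auto simp: two_sided_ideal_def)
  have JF: "x \<in> carrier F" if "x \<in> J" for x
    using J that by (auto simp: two_sided_ideal_def subspace_of_def)
  have \<pi>J: "\<pi> x \<in> J" if "x \<in> K" for x
    using KJ that by auto
  have \<pi>F: "\<pi> x \<in> carrier F" if "x \<in> carrier E" for x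
    using \<pi> that by (auto simp: bounded_linear_map_def)
  have \<pi>add: "\<pi> (x \<oplus>\<^bsub>E\<^esub> y) = \<pi> x \<oplus>\<^bsub>F\<^esub> \<pi> y" if "x \<in> carrier E" "y \<in> carrier E" for x y
    using \<pi> that by (simp add: bounded_linear_map_def)
  have \<pi>smult: "\<pi> (c \<odot>\<^bsub>E\<^esub> x) = c \<odot>\<^bsub>F\<^esub> \<pi> x" if "x \<in> carrier E" for c x
    using \<pi> that by (simp add: bounded_linear_map_def)
  have nnE: "0 \<le> nrm E x" if "x \<in> carrier E" for x
    using E that by (simp add: normed_space_def)
  have nnF: "0 \<le> nrm F x" if "x \<in> carrier F" for x
    using F that by (simp add: normed_space_def)
  have Dlin: "bounded_linear_map F (dual ?FJ) D"
    using D by (simp add: continuous_derivation_def)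
  have Ddual: "D a \<in> carrier (dual ?FJ)" if "a \<in> carrier F" for a
    using Dlin that by (auto simp: bounded_linear_map_def)
  obtain C where C: "0 \<le> C" "\<And>x. x \<in> carrier E \<Longrightarrow> nrm F (\<pi> x) \<le> C * nrm E x"
    using bounded_linear_map_bound[OF \<pi> nnE] by blast
  obtain M where M: "0 \<le> M" "\<And>a. a \<in> carrier F \<Longrightarrow> nrm (dual ?FJ) (D a) \<le> M * nrm F a"
    using bounded_linear_map_bound[OF Dlin nnF] by blast
  have bound: "cmod (D (\<pi> b) (\<pi> x)) \<le> (M * C * C * nrm E b) * nrm E x"
    if b: "b \<in> carrier E" and x: "x \<in> K" for b x
  proof -
    have "cmod (D (\<pi> b) (\<pi> x)) \<le> nrm (dual ?FJ) (D (\<pi> b)) * nrm F (\<pi> x)"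
      using dual_norm_bound[OF Ddual[OF \<pi>F[OF b]], of "\<pi> x"] \<pi>J[OF x] nnF JF by simp
    also have "\<dots> \<le> (M * (C * nrm E b)) * (C * nrm E x)"
    proof (rule mult_mono)
      show "nrm (dual ?FJ) (D (\<pi> b)) \<le> M * (C * nrm E b)"
        using M(2)[OF \<pi>F[OF b]] mult_left_mono[OF C(2)[OF b] M(1)] by linarith
    qed (use C M nnE nnF KE x b \<pi>F in auto)
    finally show ?thesis
      by (simp add: algebra_simps)
  qed
  have in_dual: "?D b \<in> carrier (dual ?EK)" if b: "b \<in> carrier E" for b
  proof -
    have "\<exists>L. \<forall>x\<in>K. cmod (D (\<pi> b) (\<pi> x)) \<le> L * nrm E x"
      using bound[OF b] by blast
    then show ?thesis
      using Ddual[OF \<pi>F[OF b]] unfolding in_carrier_dual_iff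
      by (auto simp: Kcl KE \<pi>add \<pi>smult \<pi>J)
  qed
  have lin: "bounded_linear_map E (dual ?EK) ?D"
    unfolding bounded_linear_map_def
  proof (intro conjI ballI allI)
    show "?D \<in> carrier E \<rightarrow> carrier (dual ?EK)"
      using in_dual by auto
  next
    fix a b assume ab: "a \<in> carrier E" "b \<in> carrier E"
    then have "D (\<pi> (a \<oplus>\<^bsub>E\<^esub> b)) = D (\<pi> a) \<oplus>\<^bsub>dual ?FJ\<^esub> D (\<pi> b)"
      using Dlin \<pi>F by (simp add: \<pi>add bounded_linear_map_def)
    then show "?D (a \<oplus>\<^bsub>E\<^esub> b) = ?D a \<oplus>\<^bsub>dual ?EK\<^esub> ?D b"
      by (auto simp: dual_def \<pi>J)
  next
    fix c a assume a: "a \<in> carrier E"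
    then have "D (\<pi> (c \<odot>\<^bsub>E\<^esub> a)) = c \<odot>\<^bsub>dual ?FJ\<^esub> D (\<pi> a)"
      using Dlin \<pi>F by (simp add: \<pi>smult bounded_linear_map_def)
    then show "?D (c \<odot>\<^bsub>E\<^esub> a) = c \<odot>\<^bsub>dual ?EK\<^esub> ?D a"
      by (auto simp: dual_def \<pi>J)
  next
    have "nrm (dual ?EK) (?D b) \<le> (M * C * C) * nrm E b" if b: "b \<in> carrier E" for b
      by (rule dual_norm_le) (use bound[OF b] M C nnE[OF b] in auto)
    then show "\<exists>L. \<forall>b\<in>carrier E. nrm (dual ?EK) (?D b) \<le> L * nrm E b"
      by blast
  qed
  have "?D (a \<otimes>\<^bsub>E\<^esub> b) = left_act E K a (?D b) \<oplus>\<^bsub>dual ?EK\<^esub> right_act E K (?D a) b"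
    if ab: "a \<in> carrier E" "b \<in> carrier E" for a b
  proof -
    have "D (\<pi> (a \<otimes>\<^bsub>E\<^esub> b)) =
        left_act F J (\<pi> a) (D (\<pi> b)) \<oplus>\<^bsub>dual ?FJ\<^esub> right_act F J (D (\<pi> a)) (\<pi> b)"
      using D \<pi>F ab by (simp add: mult continuous_derivation_def)
    then show ?thesis
      using ab by (auto simp: dual_def left_act_def right_act_def \<pi>J Kideal KE mult)
  qed
  with lin show ?thesis
    by (simp add: continuous_derivation_def)
qed

text \<open>
  The preimage \<open>K\<close> of a closed ideal \<open>J\<close> of \<open>S\<close> is a closed ideal of \<open>E\<close>, so the pullback to \<open>K\<close> of a
  derivation \<open>D\<close> into the dual of \<open>J\<close> is inner. Since \<open>\<pi>\<close> fixes \<open>S\<close>, the ideal \<open>K\<close> contains \<open>J\<close> and the pullback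
  restricts to \<open>D\<close>, so innerness of the pullback can be restricted to \<open>S\<close> and \<open>J\<close>.
\<close>

theorem ideally_amenable_retract:
  assumes E: "ideally_amenable E"
    and S: "subalgebra_of S E" and clS: "closedin (norm_topology E) S"
    and \<pi>: "bounded_linear_map E (E\<lparr>carrier := S\<rparr>) \<pi>"
    and retract: "\<And>x. x \<in> S \<Longrightarrow> \<pi> x = x"
    and mult: "\<And>x y. x \<in> carrier E \<Longrightarrow> y \<in> carrier E \<Longrightarrow> \<pi> (x \<otimes>\<^bsub>E\<^esub> y) = \<pi> x \<otimes>\<^bsub>E\<^esub> \<pi> y"
  shows "ideally_amenable (E\<lparr>carrier := S\<rparr>)"
  unfolding ideally_amenable_def
proof (intro conjI allI impI)
  let ?S = "E\<lparr>carrier := S\<rparr>"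
  have alg: "banach_algebra E"
    using E by (simp add: ideally_amenable_def)
  then have norm: "normed_space E" and mod: "module scalars E"
    by (simp_all add: banach_algebra_def banach_space_def normed_space_def)
  interpret module scalars E by fact
  show algS: "banach_algebra ?S"
    using alg S clS by (rule banach_algebra_subalgebra)
  have subS: "subspace_of S E" and SE: "S \<subseteq> carrier E"
    using S by (auto simp: subalgebra_of_def subspace_of_def)
  have normS: "normed_space ?S"
    using norm subS by (rule normed_space_subspace)
  fix J D
  assume "two_sided_ideal J ?S \<and> closedin (norm_topology ?S) J"
  then have J: "two_sided_ideal J ?S" and clJ: "closedin (norm_topology ?S) J"
    by simp_all
  assume D: "continuous_derivation ?S J D"
  define K where "K = {x \<in> carrier E. \<pi> x \<in> J}"
  have JS: "J \<subseteq> S"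
    using J by (auto simp: two_sided_ideal_def subspace_of_def)
  have JK: "J \<subseteq> K"
    using JS SE retract by (auto simp: K_def)
  have \<pi>S: "\<pi> x \<in> S" if "x \<in> carrier E" for x
    using \<pi> that by (auto simp: bounded_linear_map_def)
  have Kideal: "two_sided_ideal K E"
    unfolding two_sided_ideal_def subspace_of_def
  proof (intro conjI ballI allI)
    show "\<zero>\<^bsub>E\<^esub> \<in> K"
      using J JK by (auto simp: two_sided_ideal_def subspace_of_def)
    fix x y assume "x \<in> K" "y \<in> K"
    then show "x \<oplus>\<^bsub>E\<^esub> y \<in> K"
      using J \<pi> by (auto simp: K_def bounded_linear_map_def two_sided_ideal_def subspace_of_def)
  next
    fix c x assume x: "x \<in> K"
    then have "c \<odot>\<^bsub>E\<^esub> x \<in> carrier E"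
      using smult_closed[of c x] by (simp add: K_def scalars_def)
    then show "c \<odot>\<^bsub>E\<^esub> x \<in> K"
      using x J \<pi> by (auto simp: K_def bounded_linear_map_def two_sided_ideal_def subspace_of_def)
  next
    fix a x assume "a \<in> carrier E" "x \<in> K"
    then show "a \<otimes>\<^bsub>E\<^esub> x \<in> K" "x \<otimes>\<^bsub>E\<^esub> a \<in> K"
      using alg J \<pi>S by (auto simp: K_def mult banach_algebra_def two_sided_ideal_def)
  qed (auto simp: K_def)
  have "topspace (norm_topology E) = carrier E"
    by (simp add: norm_topology_def Metric_space.topspace_mtopology[OF Metric_space_vdist[OF norm]])
  then have Kclosed: "closedin (norm_topology E) K"
    using closedin_continuous_map_preimage[OF continuous_map_bounded_linear[OF norm normS \<pi>] clJ]
    by (simp add: K_def)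
  have "continuous_derivation E K (\<lambda>b. \<lambda>x\<in>K. D (\<pi> b) (\<pi> x))"
    using continuous_derivation_pullback[OF norm normS \<pi> _ Kideal J _ D] mult by (auto simp: K_def)
  then obtain \<xi> where \<xi>: "\<xi> \<in> carrier (dual (E\<lparr>carrier := K\<rparr>))"
    and "\<And>a. a \<in> carrier E \<Longrightarrow> (\<lambda>x\<in>K. D (\<pi> a) (\<pi> x)) =
      left_act E K a \<xi> \<ominus>\<^bsub>dual (E\<lparr>carrier := K\<rparr>)\<^esub> right_act E K \<xi> a"
    using E Kideal Kclosed unfolding ideally_amenable_def inner_derivation_def by blast
  then have inner: "(\<lambda>x\<in>K. D (\<pi> a) (\<pi> x)) = (\<lambda>x\<in>K. \<xi> (x \<otimes>\<^bsub>E\<^esub> a) - \<xi> (a \<otimes>\<^bsub>E\<^esub> x))"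
    if "a \<in> carrier E" for a
    using commutator_action_eq[OF alg Kideal \<xi> that] that by simp
  have "subspace_of J (E\<lparr>carrier := K\<rparr>)"
    using J JK by (auto simp: two_sided_ideal_def subspace_of_def)
  then have \<xi>J: "restrict \<xi> J \<in> carrier (dual (?S\<lparr>carrier := J\<rparr>))"
    using restrict_in_dual_subspace[OF \<xi>] by simp
  show "inner_derivation ?S J D"
    unfolding inner_derivation_def
  proof (intro bexI[OF _ \<xi>J] ballI)
    fix a assume a: "a \<in> carrier ?S"
    have "D a x = \<xi> (x \<otimes>\<^bsub>E\<^esub> a) - \<xi> (a \<otimes>\<^bsub>E\<^esub> x)" if x: "x \<in> J" for x
      using fun_cong[OF inner[of a], of x] a x JS JK SE retract by (auto simp: subset_iff)
    moreover have "D a \<in> extensional J"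
      using D a by (auto simp: continuous_derivation_def bounded_linear_map_def in_carrier_dual_iff)
    moreover have "x \<otimes>\<^bsub>E\<^esub> a \<in> J" "a \<otimes>\<^bsub>E\<^esub> x \<in> J" if "x \<in> J" for x
      using J a that by (auto simp: two_sided_ideal_def)
    ultimately have "D a = (\<lambda>x\<in>J. restrict \<xi> J (x \<otimes>\<^bsub>?S\<^esub> a) - restrict \<xi> J (a \<otimes>\<^bsub>?S\<^esub> x))"
      by (intro extensionalityI[of _ J]) auto
    then show "D a = left_act ?S J a (restrict \<xi> J)
        \<ominus>\<^bsub>dual (?S\<lparr>carrier := J\<rparr>)\<^esub> right_act ?S J (restrict \<xi> J) a"
      by (simp only: commutator_action_eq[OF algS J \<xi>J a])
  qed
qed

text \<open>
  Modulo the kernel, \<open>x\<close> and \<open>\<pi> x\<close> agree; if the kernel is an ideal, the same then holds for \<open>xy\<close> and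
  \<open>\<pi> x \<pi> y\<close>, and the latter lies in \<open>S\<close>, where \<open>\<pi>\<close> is the identity.
\<close>

lemma projection_multiplicative:
  assumes alg: "banach_algebra E" and S: "subalgebra_of S E"
    and \<pi>: "bounded_linear_map E (E\<lparr>carrier := S\<rparr>) \<pi>"
    and retract: "\<And>x. x \<in> S \<Longrightarrow> \<pi> x = x"
    and ker: "two_sided_ideal {x \<in> carrier E. \<pi> x = \<zero>\<^bsub>E\<^esub>} E"
    and x: "x \<in> carrier E" and y: "y \<in> carrier E"
  shows "\<pi> (x \<otimes>\<^bsub>E\<^esub> y) = \<pi> x \<otimes>\<^bsub>E\<^esub> \<pi> y"
proof -
  have mod: "module scalars E"
    using alg by (simp add: banach_algebra_def banach_space_def normed_space_def)
  interpret module scalars E by fact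
  have SE: "S \<subseteq> carrier E"
    using S by (simp add: subalgebra_of_def subspace_of_def)
  have \<pi>S: "\<pi> z \<in> S" "\<pi> z \<in> carrier E" if "z \<in> carrier E" for z
    using \<pi> that SE by (auto simp: bounded_linear_map_def)
  have add: "\<pi> (u \<oplus>\<^bsub>E\<^esub> v) = \<pi> u \<oplus>\<^bsub>E\<^esub> \<pi> v" if "u \<in> carrier E" "v \<in> carrier E" for u v
    using \<pi> that by (simp add: bounded_linear_map_def)
  have times: "u \<otimes>\<^bsub>E\<^esub> v \<in> carrier E" if "u \<in> carrier E" "v \<in> carrier E" for u v
    using alg that by (simp add: banach_algebra_def)
  have decomp: "\<exists>n. n \<in> carrier E \<and> \<pi> n = \<zero>\<^bsub>E\<^esub> \<and> z = \<pi> z \<oplus>\<^bsub>E\<^esub> n" if z: "z \<in> carrier E" for z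
  proof (intro exI conjI)
    let ?n = "z \<ominus>\<^bsub>E\<^esub> \<pi> z"
    show n: "?n \<in> carrier E"
      using z \<pi>S by simp
    show eq: "z = \<pi> z \<oplus>\<^bsub>E\<^esub> ?n"
      using z \<pi>S by (simp add: a_minus_def M.a_lcomm M.r_neg)
    have "\<pi> z = \<pi> z \<oplus>\<^bsub>E\<^esub> \<pi> ?n"
      using add[OF \<pi>S(2)[OF z] n] eq retract[OF \<pi>S(1)[OF z]] by simp
    then show "\<pi> ?n = \<zero>\<^bsub>E\<^esub>"
      using z n \<pi>S M.add.r_cancel_one'[of "\<pi> z" "\<pi> ?n"] by (metis M.add.l_cancel_one')
  qed
  obtain m n where m: "m \<in> carrier E" "\<pi> m = \<zero>\<^bsub>E\<^esub>" "x = \<pi> x \<oplus>\<^bsub>E\<^esub> m"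
    and n: "n \<in> carrier E" "\<pi> n = \<zero>\<^bsub>E\<^esub>" "y = \<pi> y \<oplus>\<^bsub>E\<^esub> n"
    using decomp[OF x] decomp[OF y] by blast
  have "x \<otimes>\<^bsub>E\<^esub> y = (\<pi> x \<oplus>\<^bsub>E\<^esub> m) \<otimes>\<^bsub>E\<^esub> y"
    using m(3) by simp
  also have "\<dots> = \<pi> x \<otimes>\<^bsub>E\<^esub> y \<oplus>\<^bsub>E\<^esub> m \<otimes>\<^bsub>E\<^esub> y"
    using alg m(1) \<pi>S(2)[OF x] y by (simp add: banach_algebra_def)
  also have "\<pi> x \<otimes>\<^bsub>E\<^esub> y = \<pi> x \<otimes>\<^bsub>E\<^esub> (\<pi> y \<oplus>\<^bsub>E\<^esub> n)"
    using n(3) by simp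
  also have "\<dots> = \<pi> x \<otimes>\<^bsub>E\<^esub> \<pi> y \<oplus>\<^bsub>E\<^esub> \<pi> x \<otimes>\<^bsub>E\<^esub> n"
    using alg n(1) \<pi>S(2)[OF x] \<pi>S(2)[OF y] by (simp add: banach_algebra_def)
  finally have "\<pi> (x \<otimes>\<^bsub>E\<^esub> y) = \<pi> (\<pi> x \<otimes>\<^bsub>E\<^esub> \<pi> y) \<oplus>\<^bsub>E\<^esub> \<pi> (\<pi> x \<otimes>\<^bsub>E\<^esub> n) \<oplus>\<^bsub>E\<^esub> \<pi> (m \<otimes>\<^bsub>E\<^esub> y)"
    using \<pi>S x y m(1) n(1) by (simp add: add times)
  moreover have "\<pi> (\<pi> x \<otimes>\<^bsub>E\<^esub> n) = \<zero>\<^bsub>E\<^esub>" "\<pi> (m \<otimes>\<^bsub>E\<^esub> y) = \<zero>\<^bsub>E\<^esub>"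
    using ker m n \<pi>S(2)[OF x] y by (auto simp: two_sided_ideal_def)
  moreover have "\<pi> (\<pi> x \<otimes>\<^bsub>E\<^esub> \<pi> y) = \<pi> x \<otimes>\<^bsub>E\<^esub> \<pi> y"
    using S \<pi>S x y by (intro retract) (simp add: subalgebra_of_def)
  ultimately show ?thesis
    using \<pi>S x y by (simp add: times)
qed


section \<open>The projection of \<open>L\<^sup>\<infinity>(G)\<^sup>*\<close> given by \<open>P\<close>\<close>

text \<open>
  The norm is an infimum of nonnegative essential bounds, so it is enough that the set of these is nonempty. The
  chosen representative is itself a member of \<open>F\<close>, hence essentially bounded.
\<close>

lemma Linf_norm_nonneg:
  assumes "F \<in> carrier (Linf \<mu>)"
  shows "0 \<le> nrm (Linf \<mu>) F"
proof -
  obtain f where f: "f \<in> Linf_functions \<mu>" "F = Linf_class \<mu> f"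
    using assms by (auto simp: Linf_def)
  then have "f \<in> F"
    by (simp add: Linf_class_def locally_AE_def)
  then have "representative F \<in> F"
    unfolding representative_def by (rule someI[of "\<lambda>g. g \<in> F"])
  then obtain c where c: "locally_AE \<mu> (\<lambda>x. cmod (representative F x) \<le> c)"
    using f(2) by (auto simp: Linf_class_def Linf_functions_def)
  have "locally_AE \<mu> (\<lambda>x. cmod (representative F x) \<le> max c 0)"
    unfolding locally_AE_def
  proof (intro ballI impI)
    fix B assume "B \<in> sets \<mu>" "emeasure \<mu> B < \<infinity>"
    with c have "AE x in \<mu>. x \<in> B \<longrightarrow> cmod (representative F x) \<le> c"
      by (auto simp: locally_AE_def)
    then show "AE x in \<mu>. x \<in> B \<longrightarrow> cmod (representative F x) \<le> max c 0"
      by eventually_elim auto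
  qed
  then have "{c. 0 \<le> c \<and> locally_AE \<mu> (\<lambda>x. cmod (representative F x) \<le> c)} \<noteq> {}"
    using max.cobounded2[of 0 c] by blast
  then show ?thesis
    unfolding Linf_def by (auto intro: cInf_greatest)
qed

text \<open>
  A functional vanishes on \<open>A\<close> exactly when its composition with \<open>P\<close> is zero, because \<open>P\<close> maps into \<open>A\<close> and is
  the identity there. The norm of \<open>m \<circ> P\<close> is at most \<open>\<parallel>P\<parallel> \<parallel>m\<parallel>\<close>.
\<close>

lemma adjoint_projection:
  fixes X :: "('a, 'm) normed_scheme"
  defines "PA A P \<equiv> adjoint_map X P ` carrier (dual (X\<lparr>carrier := A\<rparr>))"
  assumes nn: "\<And>x. x \<in> carrier X \<Longrightarrow> 0 \<le> nrm X x"
    and A: "subspace_of A X"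
    and P: "bounded_linear_map X (X\<lparr>carrier := A\<rparr>) P" and PA_id: "\<And>x. x \<in> A \<Longrightarrow> P x = x"
    and range: "PA A P \<subseteq> carrier (dual X)"
  shows "bounded_linear_map (dual X) ((dual X)\<lparr>carrier := PA A P\<rparr>) (adjoint_map X P)"
    and "\<And>m. m \<in> PA A P \<Longrightarrow> adjoint_map X P m = m"
    and "{m \<in> carrier (dual X). adjoint_map X P m = \<zero>\<^bsub>dual X\<^esub>} = annihilator X A"
proof -
  have AX: "x \<in> carrier X" if "x \<in> A" for x
    using A that by (auto simp: subspace_of_def)
  have P_in: "P x \<in> A" if "x \<in> carrier X" for x
    using P that by (auto simp: bounded_linear_map_def)
  show "{m \<in> carrier (dual X). adjoint_map X P m = \<zero>\<^bsub>dual X\<^esub>} = annihilator X A"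
  proof -
    have "adjoint_map X P m = \<zero>\<^bsub>dual X\<^esub> \<longleftrightarrow> (\<forall>x\<in>carrier X. m (P x) = 0)" for m
      by (auto simp: adjoint_map_def dual_def fun_eq_iff restrict_def)
    moreover have "(\<forall>x\<in>carrier X. m (P x) = 0) \<longleftrightarrow> (\<forall>x\<in>A. m x = 0)" for m
      using AX P_in PA_id by metis
    ultimately show ?thesis
      by (auto simp: annihilator_def)
  qed
  show "adjoint_map X P m = m" if "m \<in> PA A P" for m
    using that by (auto simp: PA_def adjoint_map_def P_in PA_id AX)
  obtain C where C: "0 \<le> C" "\<And>x. x \<in> carrier X \<Longrightarrow> nrm X (P x) \<le> C * nrm X x"
    using bounded_linear_map_bound[OF P nn] by auto
  have in_PA: "adjoint_map X P m \<in> PA A P" if "m \<in> carrier (dual X)" for m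
  proof -
    have "adjoint_map X P m = adjoint_map X P (restrict m A)"
      by (auto simp: adjoint_map_def P_in)
    then show ?thesis
      using restrict_in_dual_subspace[OF that A] by (auto simp: PA_def)
  qed
  have norm: "nrm (dual X) (adjoint_map X P m) \<le> C * nrm (dual X) m" if m: "m \<in> carrier (dual X)" for m
  proof (rule dual_norm_le)
    show "0 \<le> C * nrm (dual X) m"
      using C(1) dual_norm_nonneg[OF m nn] by simp
    fix x assume x: "x \<in> carrier X"
    have "cmod (m (P x)) \<le> nrm (dual X) m * nrm X (P x)"
      using dual_norm_bound[OF m nn AX[OF P_in[OF x]]] .
    also have "\<dots> \<le> nrm (dual X) m * (C * nrm X x)"
      using C(2)[OF x] dual_norm_nonneg[OF m nn] by (rule mult_left_mono)
    finally show "cmod (adjoint_map X P m x) \<le> C * nrm (dual X) m * nrm X x"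
      using x by (simp add: adjoint_map_def algebra_simps)
  qed
  show "bounded_linear_map (dual X) ((dual X)\<lparr>carrier := PA A P\<rparr>) (adjoint_map X P)"
    unfolding bounded_linear_map_def
  proof (intro conjI ballI allI)
    show "adjoint_map X P \<in> carrier (dual X) \<rightarrow> carrier ((dual X)\<lparr>carrier := PA A P\<rparr>)"
      using in_PA by simp
    show "\<exists>K. \<forall>m\<in>carrier (dual X). nrm ((dual X)\<lparr>carrier := PA A P\<rparr>) (adjoint_map X P m) \<le> K * nrm (dual X) m"
      using norm by auto
  qed (auto simp: adjoint_map_def dual_def AX P_in)
qed

theorem corollary3p6:
  fixes \<mu> :: "'g::{topological_group_add, t2_space} measure"
    and A :: "('g \<Rightarrow> complex) set set"
    and P :: "('g \<Rightarrow> complex) set \<Rightarrow> ('g \<Rightarrow> complex) set"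
  defines "PA \<equiv> adjoint_map (Linf \<mu>) P ` carrier (dual ((Linf \<mu>)\<lparr>carrier := A\<rparr>))"
  assumes "locally_compact_space (euclidean :: 'g topology)"
    and "left_haar_measure \<mu>"
    and "amenable_group \<mu>"
    and "subalgebra_of A (Linf \<mu>)"
    and "A \<noteq> {\<zero>\<^bsub>Linf \<mu>\<^esub>}"
    and "closedin (Linf_weak_star_topology \<mu>) A"
    and "self_adjoint \<mu> A"
    and "translation_invariant \<mu> A"
    and "norm_one_projection (Linf \<mu>) A P"
    and "direct_sum (Linf_dual_algebra \<mu>) PA (annihilator (Linf \<mu>) A)"
    and "two_sided_ideal (annihilator (Linf \<mu>) A) (Linf_dual_algebra \<mu>)"
    and "closedin (weak_star_topology (Linf \<mu>)) (annihilator (Linf \<mu>) A)"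
    and "subalgebra_of PA (Linf_dual_algebra \<mu>)"
    and "has_unit PA (Linf_dual_algebra \<mu>)"
    and "closedin (norm_topology (Linf_dual_algebra \<mu>)) PA"
    and "ideally_amenable (Linf_dual_algebra \<mu>)"
  shows "ideally_amenable ((Linf_dual_algebra \<mu>)\<lparr>carrier := PA\<rparr>)"
proof -
  let ?E = "Linf_dual_algebra \<mu>" and ?\<pi> = "adjoint_map (Linf \<mu>) P"
  have alg: "banach_algebra ?E"
    using assms(17) by (simp add: ideally_amenable_def)
  have A: "subspace_of A (Linf \<mu>)"
    using assms(5) by (simp add: subalgebra_of_def)
  have P: "bounded_linear_map (Linf \<mu>) ((Linf \<mu>)\<lparr>carrier := A\<rparr>) P" "\<And>x. x \<in> A \<Longrightarrow> P x = x"
    using assms(10) by (auto simp: norm_one_projection_def)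
  have dual: "PA \<subseteq> carrier (dual (Linf \<mu>))"
    using assms(14) by (auto simp: subalgebra_of_def subspace_of_def Linf_dual_algebra_def)
  note proj = adjoint_projection[OF Linf_norm_nonneg A P dual[unfolded PA_def], folded PA_def]
  \<comment> \<open>\<open>?E\<close> is the dual of \<open>L\<^sup>\<infinity>(G)\<close> with a product added, so both have the same bounded linear maps.\<close>
  have \<pi>: "bounded_linear_map ?E (?E\<lparr>carrier := PA\<rparr>) ?\<pi>"
    using proj(1) by (simp add: bounded_linear_map_def Linf_dual_algebra_def)
  have "{m \<in> carrier ?E. ?\<pi> m = \<zero>\<^bsub>?E\<^esub>} = annihilator (Linf \<mu>) A"
    using proj(3) by (simp add: Linf_dual_algebra_def)
  then have "two_sided_ideal {m \<in> carrier ?E. ?\<pi> m = \<zero>\<^bsub>?E\<^esub>} ?E"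
    using assms(12) by simp
  note mult = projection_multiplicative[OF alg assms(14) \<pi> proj(2) this]
  show ?thesis
    using assms(17,14,16) \<pi> proj(2) mult by (rule ideally_amenable_retract)
qed

end
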